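(* For every graph $G=(V,E)$, the following statements are equivalent. (1) $G$ is a median graph. (2) Every $v\in V$ is a median-consistent vertex in every $v$-convex subgraph of $G$. (3) $G$ satisfies (C1) w.r.t. all of its vertices. (4) $G$ is connected, bipartite and satisfies (C0) and (C2) w.r.t. all of its vertices. (5) For all $u,v,w\in V$, the graph $G(u,v,w):=G(u,v)\cap G(u,w)\cap G(v,w)$ is not empty and connected, where, for $x,y\in V$, $G(x,y)$ denotes the subgraph of $G$ with vertex set $V(G(x,y))=I_G(x,y)$ and whose edge set $E(G(x,y))$ consists precisely of all edges that lie on shortest $(x,y)$-paths in $G$.
   Context: All graphs are finite, simple and undirected, with nonempty vertex set. A graph is bipartite if its vertex set can be partitioned into two (possibly empty) sets such that every edge joins the two sets. For $x,y\in V(G)$, the interval $I_G(x,y)$ is the set of all vertices lying on shortest $(x,y)$-paths in $G$ (it is empty if $x,y$ lie in different connected components), and $I_G(x,y,z):=I_G(x,y)\cap I_G(x,z)\cap I_G(y,z)$. $G$ is a median graph if it is connected and $|I_G(x,y,z)|=1$ for all $x,y,z\in V(G)$. A vertex $\mu\in V(G)$ is median-consistent in $G$ if $|I_G(\mu,x,y)|=1$ for all $x,y\in V(G)$. Subgraphs need not be induced. For $v\in V(G)$, a subgraph $H$ of $G$ is $v$-convex if $v\in V(H)$ and, for all $x\in V(H)$, every shortest path in $G$ connecting $v$ and $x$ is contained in $H$. $G[W]$ denotes the subgraph induced by $W\subseteq V(G)$; the intersection of two graphs $G,H$ is $G\cap H:=(V(G)\cap V(H),E(G)\cap E(H))$.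 For $u\in V(G)$: $G$ satisfies (C0) w.r.t. $u$ if, for all $v,w\in V(G)$, $I_G(u,v)\cap I_G(v,w)=\{v\}$ implies $v\in I_G(u,w)$; $G$ satisfies (C1) w.r.t. $u$ if, for all $v,w\in V(G)$, $G[I_G(u,v,w)]$ contains at least one vertex and is connected; $G$ satisfies (C2) w.r.t. $u$ if, for all $v,w\in V(G)$, $G[I_G(u,v,w)]$ contains an edge whenever it contains more than one vertex. *)

theory Defs
  imports Main
begin

type_synonym 'a graph = "'a set \<times> 'a set set"

abbreviation verts :: "'a graph \<Rightarrow> 'a set" where
  "verts G \<equiv> fst G"

abbreviation edges :: "'a graph \<Rightarrow> 'a set set" where
  "edges G \<equiv> snd G"

definition simple_graph :: "'a graph \<Rightarrow> bool" where
  "simple_graph G \<longleftrightarrow>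
     finite (verts G) \<and> verts G \<noteq> {} \<and> (\<forall>e\<in>edges G. e \<subseteq> verts G \<and> card e = 2)"

definition subgraph :: "'a graph \<Rightarrow> 'a graph \<Rightarrow> bool" where
  "subgraph H G \<longleftrightarrow> simple_graph H \<and> verts H \<subseteq> verts G \<and> edges H \<subseteq> edges G"

definition induced_subgraph :: "'a graph \<Rightarrow> 'a set \<Rightarrow> 'a graph" where
  "induced_subgraph G W = (verts G \<inter> W, {e \<in> edges G. e \<subseteq> W})"

definition graph_inter :: "'a graph \<Rightarrow> 'a graph \<Rightarrow> 'a graph" where
  "graph_inter G H = (verts G \<inter> verts H, edges G \<inter> edges H)"

definition bipartite :: "'a graph \<Rightarrow> bool" where
  "bipartite G \<longleftrightarrow>
     (\<exists>A B. A \<union> B = verts G \<and> A \<inter> B = {} \<and> (\<forall>e\<in>edges G. \<exists>a\<in>A. \<exists>b\<in>B. e = {a, b}))"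

text \<open>Paths are given by their nonempty lists of pairwise distinct vertices; the
  one-vertex list \<open>[x]\<close> is the only path from \<open>x\<close> to \<open>x\<close>.\<close>

definition path_edges :: "'a list \<Rightarrow> 'a set set" where
  "path_edges p = {{p ! i, p ! Suc i} | i. Suc i < length p}"

definition path_between :: "'a graph \<Rightarrow> 'a \<Rightarrow> 'a \<Rightarrow> 'a list \<Rightarrow> bool" where
  "path_between G x y p \<longleftrightarrow>
     p \<noteq> [] \<and> hd p = x \<and> last p = y \<and> distinct p \<and>
     set p \<subseteq> verts G \<and> path_edges p \<subseteq> edges G"

definition shortest_path :: "'a graph \<Rightarrow> 'a \<Rightarrow> 'a \<Rightarrow> 'a list \<Rightarrow> bool" where
  "shortest_path G x y p \<longleftrightarrow>
     path_between G x y p \<and> (\<forall>q. path_between G x y q \<longrightarrow> length p \<le> length q)"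

text \<open>The graph without vertices is connected in this sense; nonemptiness is required
  separately wherever it is needed.\<close>

definition connected_graph :: "'a graph \<Rightarrow> bool" where
  "connected_graph G \<longleftrightarrow> (\<forall>x\<in>verts G. \<forall>y\<in>verts G. \<exists>p. path_between G x y p)"

definition interval :: "'a graph \<Rightarrow> 'a \<Rightarrow> 'a \<Rightarrow> 'a set" where
  "interval G x y = {z. \<exists>p. shortest_path G x y p \<and> z \<in> set p}"

definition interval3 :: "'a graph \<Rightarrow> 'a \<Rightarrow> 'a \<Rightarrow> 'a \<Rightarrow> 'a set" where
  "interval3 G x y z = interval G x y \<inter> interval G x z \<inter> interval G y z"

definition median_graph :: "'a graph \<Rightarrow> bool" where
  "median_graph G \<longleftrightarrow>
     connected_graph G \<and>
     (\<forall>x\<in>verts G. \<forall>y\<in>verts G. \<forall>z\<in>verts G. card (interval3 G x y z) = 1)"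

definition median_consistent :: "'a graph \<Rightarrow> 'a \<Rightarrow> bool" where
  "median_consistent G \<mu> \<longleftrightarrow>
     \<mu> \<in> verts G \<and> (\<forall>x\<in>verts G. \<forall>y\<in>verts G. card (interval3 G \<mu> x y) = 1)"

definition convex_subgraph :: "'a graph \<Rightarrow> 'a \<Rightarrow> 'a graph \<Rightarrow> bool" where
  "convex_subgraph G v H \<longleftrightarrow>
     subgraph H G \<and> v \<in> verts H \<and>
     (\<forall>x\<in>verts H. \<forall>p. shortest_path G v x p \<longrightarrow> set p \<subseteq> verts H \<and> path_edges p \<subseteq> edges H)"

definition C0 :: "'a graph \<Rightarrow> 'a \<Rightarrow> bool" where
  "C0 G u \<longleftrightarrow>
     (\<forall>v\<in>verts G. \<forall>w\<in>verts G.
        interval G u v \<inter> interval G v w = {v} \<longrightarrow> v \<in> interval G u w)"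

definition C1 :: "'a graph \<Rightarrow> 'a \<Rightarrow> bool" where
  "C1 G u \<longleftrightarrow>
     (\<forall>v\<in>verts G. \<forall>w\<in>verts G.
        let K = induced_subgraph G (interval3 G u v w)
        in verts K \<noteq> {} \<and> connected_graph K)"

definition C2 :: "'a graph \<Rightarrow> 'a \<Rightarrow> bool" where
  "C2 G u \<longleftrightarrow>
     (\<forall>v\<in>verts G. \<forall>w\<in>verts G.
        let K = induced_subgraph G (interval3 G u v w)
        in card (verts K) > 1 \<longrightarrow> edges K \<noteq> {})"

definition interval_graph :: "'a graph \<Rightarrow> 'a \<Rightarrow> 'a \<Rightarrow> 'a graph" where
  "interval_graph G x y =
     (interval G x y, {e. \<exists>p. shortest_path G x y p \<and> e \<in> path_edges p})"

definition interval_graph3 :: "'a graph \<Rightarrow> 'a \<Rightarrow> 'a \<Rightarrow> 'a \<Rightarrow> 'a graph" where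
  "interval_graph3 G u v w =
     graph_inter (graph_inter (interval_graph G u v) (interval_graph G u w)) (interval_graph G v w)"

end

theory Submission
  imports Defs
begin

text \<open>In a connected graph, \<open>z \<in> I(x, y)\<close> iff \<open>d(x, z) + d(z, y) = d(x, y)\<close>. If two adjacent
  vertices both lie in \<open>I(u, v, w)\<close>, then adding up these equations shows that they have the same
  distance from \<open>u\<close>, which is impossible in a bipartite graph; hence (C1), (C2) or the
  connectedness of \<open>G(u, v, w)\<close> leaves room for at most one median. Nonemptiness of all
  \<open>I(u, v, w)\<close> forces bipartiteness (take an edge \<open>vw\<close>), and under (C0) a vertex of
  \<open>I(u, v) \<inter> I(v, w)\<close> farthest from \<open>v\<close> is a median. Finally, in a median graph, shortest paths
  from \<open>x\<close> and \<open>y\<close> to \<open>v\<close> through the median of \<open>v, x, y\<close> show that \<open>v\<close>-convex subgraphs are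
  isometric.\<close>

section \<open>Walks\<close>

lemma path_edges_Nil [simp]: "path_edges [] = {}"
  by (simp add: path_edges_def)

lemma path_edges_single [simp]: "path_edges [x] = {}"
  by (simp add: path_edges_def)

lemma path_edges_Cons2 [simp]: "path_edges (x # y # zs) = insert {x, y} (path_edges (y # zs))"
proof (intro set_eqI iffI)
  fix e assume "e \<in> path_edges (x # y # zs)"
  then obtain i where i: "e = {(x # y # zs) ! i, (x # y # zs) ! Suc i}" "Suc i < length (x # y # zs)"
    unfolding path_edges_def by blast
  then show "e \<in> insert {x, y} (path_edges (y # zs))"
    by (cases i) (auto simp: path_edges_def)
next
  fix e assume "e \<in> insert {x, y} (path_edges (y # zs))"
  then consider "e = {x, y}" | i where "e = {(y # zs) ! i, (y # zs) ! Suc i}" "Suc i < length (y # zs)"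
    unfolding path_edges_def by blast
  then show "e \<in> path_edges (x # y # zs)"
  proof cases
    case 1
    then show ?thesis unfolding path_edges_def by (intro CollectI exI[of _ 0]) auto
  next
    case (2 i)
    then show ?thesis unfolding path_edges_def by (intro CollectI exI[of _ "Suc i"]) auto
  qed
qed

lemma path_edges_append: "path_edges (xs @ y # zs) = path_edges (xs @ [y]) \<union> path_edges (y # zs)"
proof (induction xs)
  case (Cons x xs)
  then show ?case by (cases xs) auto
qed simp

lemma path_edges_rev [simp]: "path_edges (rev xs) = path_edges xs"
proof (induction xs rule: induct_list012)
  case (3 x y zs)
  then show ?case
    using path_edges_append[of "rev zs" y "[x]"] by (auto simp: insert_commute)
qed auto

lemma path_edges_subset: "e \<in> path_edges p \<Longrightarrow> e \<subseteq> set p"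
  by (auto simp: path_edges_def)

text \<open>Unlike paths, walks may repeat vertices, so gluing two of them gives a walk again;
  distinctness is recovered afterwards by shortening.\<close>

definition walk :: "'a graph \<Rightarrow> 'a \<Rightarrow> 'a \<Rightarrow> 'a list \<Rightarrow> bool" where
  "walk G x y p \<longleftrightarrow>
     p \<noteq> [] \<and> hd p = x \<and> last p = y \<and> set p \<subseteq> verts G \<and> path_edges p \<subseteq> edges G"

lemma path_between_walk: "path_between G x y p \<longleftrightarrow> walk G x y p \<and> distinct p"
  by (auto simp: path_between_def walk_def)

lemma walk_split:
  "walk G x y (p @ z # q) \<longleftrightarrow> walk G x z (p @ [z]) \<and> walk G z y (z # q)"
  unfolding walk_def path_edges_append[of p z q] by (cases p) auto

lemma walk_append:
  assumes "walk G x z p" "walk G z y q"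
  shows "walk G x y (butlast p @ q)"
proof -
  have "p \<noteq> []" "last p = z" using assms(1) by (simp_all add: walk_def)
  then have "butlast p @ [z] = p" by (metis append_butlast_last_id)
  moreover have "z # tl q = q" using assms(2) by (auto simp: walk_def)
  ultimately show ?thesis using walk_split[of G x y "butlast p" z "tl q"] assms by simp
qed

lemma walk_rev: "walk G x y p \<Longrightarrow> walk G y x (rev p)"
  by (auto simp: walk_def hd_rev last_rev)

lemma walk_edge:
  assumes "simple_graph G" "{x, y} \<in> edges G"
  shows "walk G x y [x, y]"
  using assms by (auto simp: walk_def simple_graph_def)

text \<open>A repeated vertex \<open>z\<close> bounds a closed piece of the walk, and cutting this
  piece out keeps both ends.\<close>

lemma walk_shorten:
  assumes "walk G x y p" "\<not> distinct p"
  obtains q where "walk G x y q" "length q < length p"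
proof -
  obtain xs ys zs z where p: "p = xs @ [z] @ ys @ [z] @ zs"
    using not_distinct_decomp[OF assms(2)] by blast
  have "walk G x y (xs @ z # zs)"
    using assms(1) walk_split[of G x y xs z "ys @ z # zs"] walk_split[of G z y "z # ys" z zs]
    by (auto simp: p walk_split[of G x y xs z zs])
  then show ?thesis using that p by simp
qed

lemma walk_imp_path:
  assumes "walk G x y p"
  obtains q where "path_between G x y q" "length q \<le> length p"
proof -
  obtain q where q: "walk G x y q" "\<And>r. walk G x y r \<Longrightarrow> length q \<le> length r"
    using ex_has_least_nat[of "walk G x y" p length] assms by blast
  then have "distinct q" using walk_shorten[of G x y q] by (metis not_le)
  then show ?thesis using that q assms by (simp add: path_between_walk)
qed

section \<open>Distances\<close>

text \<open>Counts edges, hence one less than the number of list entries. If no walk joins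
  \<open>x\<close> to \<open>y\<close>, the value is unspecified, so facts about it assume a walk or
  connectedness.\<close>

definition gdist :: "'a graph \<Rightarrow> 'a \<Rightarrow> 'a \<Rightarrow> nat" where
  "gdist G x y = (LEAST n. \<exists>p. walk G x y p \<and> length p = Suc n)"

lemma gdist_le:
  assumes "walk G x y p"
  shows "gdist G x y < length p"
proof -
  have "length p = Suc (length p - 1)" using assms by (simp add: walk_def)
  then have "gdist G x y \<le> length p - 1"
    unfolding gdist_def using assms by (intro Least_le) blast
  then show ?thesis using \<open>length p = _\<close> by linarith
qed

lemma gdist_attained:
  assumes "walk G x y p"
  obtains q where "walk G x y q" "length q = Suc (gdist G x y)"
proof -
  have "length p = Suc (length p - 1)" using assms by (simp add: walk_def)
  then have "\<exists>q. walk G x y q \<and> length q = Suc (length p - 1)" using assms by blast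
  then have "\<exists>q. walk G x y q \<and> length q = Suc (gdist G x y)"
    unfolding gdist_def by (rule LeastI)
  then show ?thesis using that by blast
qed

text \<open>Repetitions can be cut out, so a walk of minimal length is a path, and minimality among
  paths agrees with minimality among walks.\<close>

lemma shortest_path_iff: "shortest_path G x y p \<longleftrightarrow> walk G x y p \<and> length p = Suc (gdist G x y)"
proof (intro iffI conjI)
  assume sp: "shortest_path G x y p"
  then show w: "walk G x y p" by (simp add: shortest_path_def path_between_walk)
  obtain q where q: "walk G x y q" "length q = Suc (gdist G x y)" using gdist_attained[OF w] .
  obtain r where "path_between G x y r" "length r \<le> length q" using walk_imp_path[OF q(1)] .
  then have "length p \<le> length q" using sp unfolding shortest_path_def by fastforce
  then show "length p = Suc (gdist G x y)" using gdist_le[OF w] q(2) by linarith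
next
  assume p: "walk G x y p \<and> length p = Suc (gdist G x y)"
  then have min: "length p \<le> length q" if "walk G x y q" for q
    using gdist_le[OF that] by linarith
  have "distinct p"
    using walk_shorten[of G x y p] p min by (metis not_le)
  then show "shortest_path G x y p"
    using p min by (simp add: shortest_path_def path_between_walk)
qed

lemma interval_subset_verts: "interval G x y \<subseteq> verts G"
  by (auto simp: interval_def shortest_path_def path_between_def)

lemma connected_graph_alt:
  "connected_graph G \<longleftrightarrow> (\<forall>x\<in>verts G. \<forall>y\<in>verts G. \<exists>p. walk G x y p)"
  unfolding connected_graph_def by (metis path_between_walk walk_imp_path)

text \<open>An element of I(x, y) lies on an actual path, so the triple \<open>x\<close>,
  \<open>y\<close>, \<open>y\<close> already yields a path from \<open>x\<close> to
  \<open>y\<close>.\<close>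

lemma connected_graph_if_interval3:
  assumes "\<And>x y z. x \<in> verts G \<Longrightarrow> y \<in> verts G \<Longrightarrow> z \<in> verts G \<Longrightarrow> interval3 G x y z \<noteq> {}"
  shows "connected_graph G"
  unfolding connected_graph_def
proof (intro ballI)
  fix x y assume "x \<in> verts G" "y \<in> verts G"
  then have "interval3 G x y y \<noteq> {}" using assms by blast
  then show "\<exists>p. path_between G x y p"
    by (auto simp: interval3_def interval_def shortest_path_def)
qed

section \<open>Distances and intervals in a fixed connected graph\<close>

locale connected_simple_graph =
  fixes G :: "'a graph"
  assumes simple: "simple_graph G" and connected: "connected_graph G"
begin

abbreviation "V \<equiv> verts G"
abbreviation "d \<equiv> gdist G"

lemma ex_geodesic:
  assumes "x \<in> V" "y \<in> V"
  obtains p where "walk G x y p" "length p = Suc (d x y)"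
  using connected assms gdist_attained unfolding connected_graph_alt by metis

lemma dist_sym:
  assumes "x \<in> V" "y \<in> V"
  shows "d x y = d y x"
proof -
  have "d b a \<le> d a b" if ab: "a \<in> V" "b \<in> V" for a b
  proof -
    obtain p where "walk G a b p" "length p = Suc (d a b)" using ex_geodesic[OF ab] .
    then show ?thesis using gdist_le[OF walk_rev] by fastforce
  qed
  then show ?thesis using assms by (simp add: le_antisym)
qed

lemma dist_eq_0_iff:
  assumes "x \<in> V" "y \<in> V"
  shows "d x y = 0 \<longleftrightarrow> x = y"
proof
  obtain p where p: "walk G x y p" "length p = Suc (d x y)" using ex_geodesic[OF assms] .
  assume "d x y = 0"
  then show "x = y" using p by (cases p) (auto simp: walk_def)
next
  assume "x = y"
  moreover have "walk G x x [x]" using assms by (simp add: walk_def)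
  ultimately show "d x y = 0" using gdist_le by fastforce
qed

text \<open>Two geodesics are glued at \<open>z\<close>; the shared entry is counted once, hence the
  single \<open>Suc\<close>.\<close>

lemma ex_walk_through:
  assumes "x \<in> V" "y \<in> V" "z \<in> V"
  obtains p where "walk G x y p" "length p = Suc (d x z + d z y)" "z \<in> set p"
proof -
  obtain p where p: "walk G x z p" "length p = Suc (d x z)" using ex_geodesic assms by metis
  obtain q where q: "walk G z y q" "length q = Suc (d z y)" using ex_geodesic assms by metis
  have "z \<in> set q" using q(1) by (auto simp: walk_def)
  then show ?thesis using that walk_append[OF p(1) q(1)] p(2) q(2) by simp
qed

lemma dist_triangle:
  assumes "x \<in> V" "y \<in> V" "z \<in> V"
  shows "d x y \<le> d x z + d z y"
proof -
  obtain p where "walk G x y p" "length p = Suc (d x z + d z y)"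
    using ex_walk_through[OF assms] .
  then show ?thesis using gdist_le by fastforce
qed

text \<open>A geodesic cut at \<open>z\<close> leaves pieces at least as long as the distances of
  their ends, and the triangle inequality forces equality. Conversely, two geodesics glued at
  \<open>z\<close> have the length of a geodesic.\<close>

lemma in_interval_iff:
  assumes "x \<in> V" "y \<in> V"
  shows "z \<in> interval G x y \<longleftrightarrow> z \<in> V \<and> d x z + d z y = d x y"
proof (intro iffI conjI)
  assume z: "z \<in> interval G x y"
  then show zV: "z \<in> V" using interval_subset_verts by fast
  obtain p where p: "walk G x y p" "length p = Suc (d x y)" "z \<in> set p"
    using z by (auto simp: interval_def shortest_path_iff)
  obtain p1 p2 where split: "p = p1 @ z # p2" using split_list[OF p(3)] by blast
  then have "d x z < length (p1 @ [z])" "d z y < length (z # p2)"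
    using p(1) gdist_le walk_split[of G x y p1 z p2] by metis+
  then have "d x z + d z y \<le> d x y" using p(2) split by simp
  then show "d x z + d z y = d x y" using dist_triangle[OF assms zV] by simp
next
  assume z: "z \<in> V \<and> d x z + d z y = d x y"
  then obtain p where "walk G x y p" "length p = Suc (d x y)" "z \<in> set p"
    using ex_walk_through[OF assms] by metis
  then show "z \<in> interval G x y" by (auto simp: interval_def shortest_path_iff)
qed

lemma in_interval3_iff:
  assumes "x \<in> V" "y \<in> V" "z \<in> V"
  shows "m \<in> interval3 G x y z \<longleftrightarrow>
    m \<in> V \<and> d x m + d m y = d x y \<and> d x m + d m z = d x z \<and> d y m + d m z = d y z"
  using assms by (auto simp: interval3_def in_interval_iff)

lemma edgeE:
  assumes "e \<in> edges G"
  obtains x y where "e = {x, y}"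
  using simple assms card_2_iff[of e] unfolding simple_graph_def by blast

lemma edge_verts: "{x, y} \<in> edges G \<Longrightarrow> x \<in> V \<and> y \<in> V"
  using simple by (auto simp: simple_graph_def)

lemma dist_edge:
  assumes "{x, y} \<in> edges G"
  shows "d x y = 1"
proof -
  have "x \<noteq> y" using simple assms by (auto simp: simple_graph_def)
  moreover have "d x y < 2" using gdist_le[OF walk_edge[OF simple assms]] by simp
  ultimately show ?thesis using dist_eq_0_iff edge_verts[OF assms] by fastforce
qed

section \<open>Bipartiteness\<close>

text \<open>If both ends were equally far from \<open>u\<close>, a median \<open>m\<close> of
  \<open>u\<close>, \<open>x\<close>, \<open>y\<close> would be equally far from \<open>x\<close>
  and \<open>y\<close>; but these two distances add up to 1.\<close>

lemma dist_edge_neq_if_interval3: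
  assumes ne: "\<And>x y z. x \<in> V \<Longrightarrow> y \<in> V \<Longrightarrow> z \<in> V \<Longrightarrow> interval3 G x y z \<noteq> {}"
    and u: "u \<in> V" and e: "{x, y} \<in> edges G"
  shows "d u x \<noteq> d u y"
proof
  assume eq: "d u x = d u y"
  have xy: "x \<in> V" "y \<in> V" using edge_verts[OF e] by auto
  obtain m where m: "m \<in> V" "d u m + d m x = d u x" "d u m + d m y = d u y" "d x m + d m y = d x y"
    using ne[OF u xy] in_interval3_iff[OF u xy] by blast
  then show False using eq dist_edge[OF e] dist_sym[OF xy(1) m(1)] by presburger
qed

text \<open>The classes are given by the parity of the distance from a fixed vertex: along an edge
  this distance changes by at most 1, hence by exactly 1.\<close>

lemma bipartite_if_dist_edge_neq:
  assumes "\<And>u x y. u \<in> V \<Longrightarrow> {x, y} \<in> edges G \<Longrightarrow> d u x \<noteq> d u y"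
  shows "bipartite G"
proof -
  obtain u where u: "u \<in> V" using simple by (auto simp: simple_graph_def)
  let ?A = "{x \<in> V. even (d u x)}" and ?B = "{x \<in> V. odd (d u x)}"
  have "\<exists>a\<in>?A. \<exists>b\<in>?B. e = {a, b}" if eG: "e \<in> edges G" for e
  proof -
    obtain x y where xy: "e = {x, y}" using edgeE[OF eG] .
    then have e: "{x, y} \<in> edges G" "{y, x} \<in> edges G"
      using that by (auto simp: insert_commute)
    have V: "x \<in> V" "y \<in> V" using edge_verts[OF e(1)] by auto
    have "d u x \<le> d u y + 1" "d u y \<le> d u x + 1"
      using dist_triangle[OF u V] dist_triangle[OF u V(2,1)] dist_edge[OF e(1)] dist_edge[OF e(2)]
      by simp_all
    then have "d u x = Suc (d u y) \<or> d u y = Suc (d u x)"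
      using assms[OF u e(1)] by linarith
    then have "even (d u x) \<longleftrightarrow> odd (d u y)" by auto
    then show ?thesis using V xy insert_commute[of x y "{}"] by blast
  qed
  moreover have "?A \<union> ?B = V" "?A \<inter> ?B = {}" by auto
  ultimately show ?thesis unfolding bipartite_def by blast
qed

text \<open>Sides alternate along a walk, so the parity of \<open>d u z\<close> tells whether
  \<open>z\<close> is on the side of \<open>u\<close>; the ends of an edge are on different
  sides.\<close>

lemma dist_edge_neq_if_bipartite:
  assumes "bipartite G" and u: "u \<in> V" and e: "{x, y} \<in> edges G"
  shows "d u x \<noteq> d u y"
proof -
  obtain A B where AB: "A \<inter> B = {}"
    "\<forall>e\<in>edges G. \<exists>a\<in>A. \<exists>b\<in>B. e = {a, b}"
    using assms(1) unfolding bipartite_def by blast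
  have flip: "a \<in> A \<longleftrightarrow> b \<notin> A" if ab: "{a, b} \<in> edges G" for a b
  proof -
    obtain a' b' where "a' \<in> A" "b' \<in> B" "{a, b} = {a', b'}"
      using bspec[OF AB(2) ab] by (elim bexE)
    then show ?thesis using AB(1) by (metis disjoint_iff doubleton_eq_iff)
  qed
  \<comment> \<open>The length counts vertices, so odd length means an even number of side
    changes.\<close>
  have parity: "path_edges p \<subseteq> edges G \<Longrightarrow> p \<noteq> [] \<Longrightarrow>
      (hd p \<in> A \<longleftrightarrow> last p \<in> A) \<longleftrightarrow> odd (length p)" for p
  proof (induction p rule: induct_list012)
    case (3 a b ps)
    then have "{a, b} \<in> edges G" by simp
    from flip[OF this] 3 show ?case by (cases "b \<in> A"; cases "last (b # ps) \<in> A") simp_all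
  qed auto
  have dist: "(u \<in> A \<longleftrightarrow> z \<in> A) \<longleftrightarrow> even (d u z)" if z: "z \<in> V" for z
  proof -
    obtain p where "walk G u z p" "length p = Suc (d u z)" using ex_geodesic[OF u z] .
    then show ?thesis using parity[of p] by (auto simp: walk_def)
  qed
  show ?thesis
    using dist[of x] dist[of y] edge_verts[OF e] flip[OF e] by auto
qed

section \<open>Medians\<close>

text \<open>The equations for membership in I(u, v, w) fix \<open>2 * d u x\<close> as
  \<open>d u v + d u w - d v w\<close>, so all members have the same distance from
  \<open>u\<close>.\<close>

lemma no_edge_in_interval3:
  assumes V: "u \<in> V" "v \<in> V" "w \<in> V" and e: "{x, y} \<in> edges G"
    and neq: "d u x \<noteq> d u y"
  shows "\<not> {x, y} \<subseteq> interval3 G u v w"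
proof
  assume "{x, y} \<subseteq> interval3 G u v w"
  then have xy: "x \<in> interval3 G u v w" "y \<in> interval3 G u v w" by auto
  note x = xy(1)[unfolded in_interval3_iff[OF V]]
  note y = xy(2)[unfolded in_interval3_iff[OF V]]
  have "d v x = d x v" "d v y = d y v" using dist_sym V x y by auto
  then show False using x y neq by linarith
qed

text \<open>Common target of all implications that lead back to median graphs: nonemptiness also
  makes the ends of any edge differ in distance from \<open>x\<close>, which excludes the edge that
  a second median would produce.\<close>

lemma median_graphI:
  assumes ne: "\<And>x y z. x \<in> V \<Longrightarrow> y \<in> V \<Longrightarrow> z \<in> V \<Longrightarrow> interval3 G x y z \<noteq> {}"
    and edge: "\<And>x y z. x \<in> V \<Longrightarrow> y \<in> V \<Longrightarrow> z \<in> V \<Longrightarrow> card (interval3 G x y z) > 1 \<Longrightarrow>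
       \<exists>e\<in>edges G. e \<subseteq> interval3 G x y z"
  shows "median_graph G"
  unfolding median_graph_def
proof (intro conjI ballI)
  fix x y z assume V: "x \<in> V" "y \<in> V" "z \<in> V"
  have "finite (interval3 G x y z)"
    using simple interval_subset_verts[of G x y] unfolding interval3_def simple_graph_def
    by (metis finite_Int finite_subset)
  then have "card (interval3 G x y z) \<noteq> 0" using ne[OF V] by auto
  moreover have "\<not> card (interval3 G x y z) > 1"
  proof
    assume "card (interval3 G x y z) > 1"
    then obtain e where e: "e \<in> edges G" "e \<subseteq> interval3 G x y z" using edge[OF V] by blast
    obtain a b where "e = {a, b}" using edgeE[OF e(1)] .
    then show False
      using e no_edge_in_interval3[OF V] dist_edge_neq_if_interval3[OF ne V(1)] by blast
  qed
  ultimately show "card (interval3 G x y z) = 1" by linarith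
qed (rule connected)

lemma interval3_nonempty_if_C0:
  assumes "C0 G u" and V: "u \<in> V" "v \<in> V" "w \<in> V"
  shows "interval3 G u v w \<noteq> {}"
proof -
  let ?S = "interval G u v \<inter> interval G v w"
  have refl: "d v v = 0" using dist_eq_0_iff V by blast
  \<comment> \<open>\<open>v\<close> witnesses that the set over which the maximum is taken is
    nonempty.\<close>
  then have "v \<in> ?S" using V by (simp add: in_interval_iff)
  moreover have "finite ?S"
    using simple interval_subset_verts[of G u v] unfolding simple_graph_def
    by (metis finite_Int finite_subset)
  ultimately have "Max (d v ` ?S) \<in> d v ` ?S" by (intro Max_in) auto
  then obtain x where x: "x \<in> ?S" "Max (d v ` ?S) = d v x" by blast
  have max: "d v z \<le> d v x" if "z \<in> ?S" for z
    using \<open>finite ?S\<close> that x(2) by (metis Max_ge finite_imageI imageI)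
  have xd: "x \<in> V" "d u x + d x v = d u v" "d v x + d x w = d v w"
    using x V by (auto simp: in_interval_iff)
  \<comment> \<open>Any such \<open>z\<close> lies in \<open>?S\<close> again and satisfies
    \<open>d v z = d v x + d x z\<close>, so maximality of \<open>d v x\<close> leaves only
    \<open>d x z = 0\<close>.\<close>
  have "z = x" if "z \<in> interval G u x" "z \<in> interval G x w" for z
  proof -
    have z: "z \<in> V" "d u z + d z x = d u x" "d x z + d z w = d x w"
      using that V xd(1) by (auto simp: in_interval_iff)
    have tri: "d z v \<le> d z x + d x v" "d v z \<le> d v x + d x z"
      "d u v \<le> d u z + d z v" "d v w \<le> d v z + d z w"
      using dist_triangle V xd(1) z(1) by auto
    have "d u z + d z v = d u v" "d v z + d z w = d v w" using tri z xd by linarith+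
    then have "z \<in> ?S" using V z(1) by (simp add: in_interval_iff)
    moreover have "d v z = d v x + d x z" using tri z xd by linarith
    ultimately have "d x z = 0" using max[of z] by linarith
    then show ?thesis using dist_eq_0_iff xd(1) z(1) by blast
  qed
  moreover have "x \<in> interval G u x" "x \<in> interval G x w"
    using V xd(1) dist_eq_0_iff by (auto simp: in_interval_iff)
  ultimately have "interval G u x \<inter> interval G x w = {x}" by blast
  \<comment> \<open>(C0) is applied with \<open>x\<close> in the middle; it supplies the third
    interval, the other two being those of \<open>?S\<close>.\<close>
  then have "x \<in> interval G u w" using assms(1) xd(1) V by (auto simp: C0_def)
  then show ?thesis using x by (auto simp: interval3_def)
qed

text \<open>The premise of (C0) leaves \<open>v\<close> as the only candidate for a median of
  \<open>u\<close>, \<open>v\<close>, \<open>w\<close>.\<close>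

lemma C0_if_interval3_nonempty:
  assumes ne: "\<And>x y z. x \<in> V \<Longrightarrow> y \<in> V \<Longrightarrow> z \<in> V \<Longrightarrow> interval3 G x y z \<noteq> {}"
    and u: "u \<in> V"
  shows "C0 G u"
  unfolding C0_def
proof (intro ballI impI)
  fix v w assume V: "v \<in> V" "w \<in> V" and "interval G u v \<inter> interval G v w = {v}"
  then have "interval3 G u v w \<subseteq> {v}" by (auto simp: interval3_def)
  then have "v \<in> interval3 G u v w" using ne[OF u V] by blast
  then show "v \<in> interval G u w" by (simp add: interval3_def)
qed

text \<open>Once \<open>H\<close> is isometric, its medians of \<open>v\<close>, \<open>x\<close>,
  \<open>y\<close> are those of \<open>G\<close> lying in \<open>H\<close>, and the unique one does
  lie there, being on a geodesic from \<open>v\<close> to \<open>x\<close>.\<close>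

lemma median_consistent_convex_subgraph:
  assumes med: "median_graph G" and v: "v \<in> V" and conv: "convex_subgraph G v H"
  shows "median_consistent H v"
proof -
  have sub: "simple_graph H" "verts H \<subseteq> V" "edges H \<subseteq> edges G" and vH: "v \<in> verts H"
    using conv by (auto simp: convex_subgraph_def subgraph_def)
  \<comment> \<open>Convexity preserves only geodesics starting at \<open>v\<close>; everything
    about other pairs has to be derived from these.\<close>
  have geo: "walk H v x p" if "x \<in> verts H" "walk G v x p" "length p = Suc (d v x)" for x p
    using conv that by (auto simp: convex_subgraph_def walk_def shortest_path_iff)
  have walk_G: "walk G x y p" if "walk H x y p" for x y p
    using that sub by (auto simp: walk_def)
  have conn: "connected_graph H"
    unfolding connected_graph_alt
  proof (intro ballI)
    fix x y assume xy: "x \<in> verts H" "y \<in> verts H"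
    obtain p where p: "walk H v x p"
      using ex_geodesic[OF v] geo xy(1) sub(2) by (metis subsetD)
    obtain q where q: "walk H v y q"
      using ex_geodesic[OF v] geo xy(2) sub(2) by (metis subsetD)
    show "\<exists>p. walk H x y p" using walk_append[OF walk_rev[OF p] q] by blast
  qed
  interpret H: connected_simple_graph H by unfold_locales (fact sub(1) conn)+
  have ge: "d x y \<le> gdist H x y" if xy: "x \<in> verts H" "y \<in> verts H" for x y
  proof -
    obtain p where "walk H x y p" "length p = Suc (gdist H x y)" using H.ex_geodesic[OF xy] .
    then show ?thesis using gdist_le[OF walk_G] by fastforce
  qed
  \<comment> \<open>The part after \<open>m\<close> of a geodesic from \<open>v\<close> to
    \<open>x\<close> stays in \<open>H\<close> and is itself a geodesic of \<open>G\<close>.\<close>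
  have via: "m \<in> verts H \<and> gdist H m x \<le> d m x"
    if x: "x \<in> verts H" and m: "m \<in> interval G v x" for x m
  proof -
    obtain p where p: "walk G v x p" "length p = Suc (d v x)" "m \<in> set p"
      using m by (auto simp: interval_def shortest_path_iff)
    obtain p1 p2 where split: "p = p1 @ m # p2" using split_list[OF p(3)] by blast
    have "walk H v x (p1 @ m # p2)" using geo[OF x p(1,2)] split by simp
    then have mx: "walk H m x (m # p2)" using walk_split[of H v x p1 m p2] by blast
    then have mH: "m \<in> verts H" by (simp add: walk_def)
    have "d v m < length (p1 @ [m])"
      using p(1) split gdist_le walk_split[of G v x p1 m p2] by metis
    moreover have "d v m + d m x = d v x" using m in_interval_iff v x sub(2) by blast
    ultimately have "gdist H m x \<le> d m x" using gdist_le[OF mx] p(2) split by simp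
    then show ?thesis using mH by simp
  qed
  have med1: "\<exists>m. interval3 G v x y = {m}" if "x \<in> V" "y \<in> V" for x y
    using med v that by (auto simp: median_graph_def card_1_singleton_iff)
  have iso: "gdist H x y = d x y" if xy: "x \<in> verts H" "y \<in> verts H" for x y
  proof -
    have V: "x \<in> V" "y \<in> V" using xy sub(2) by auto
    \<comment> \<open>Through the median \<open>m\<close> of \<open>v\<close>, \<open>x\<close>,
      \<open>y\<close>, the two tails in \<open>H\<close> combine to a walk from \<open>x\<close> to
      \<open>y\<close> of length \<open>d x y\<close>.\<close>
    obtain m where m: "m \<in> interval3 G v x y" using med1[OF V] by blast
    have mH: "m \<in> verts H" "gdist H m x \<le> d m x" "gdist H m y \<le> d m y"
      using via[OF xy(1)] via[OF xy(2)] m by (auto simp: interval3_def)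
    have "gdist H x y \<le> gdist H x m + gdist H m y" using H.dist_triangle xy mH(1) by blast
    moreover have "gdist H x m = gdist H m x" using H.dist_sym xy mH(1) by blast
    moreover have "d x m = d m x" using dist_sym V mH(1) sub(2) by blast
    moreover have "d x m + d m y = d x y" using m in_interval3_iff[OF v V] by blast
    ultimately show ?thesis using ge[OF xy] mH by linarith
  qed
  have "card (interval3 H v x y) = 1" if xy: "x \<in> verts H" "y \<in> verts H" for x y
  proof -
    have V: "x \<in> V" "y \<in> V" using xy sub(2) by auto
    obtain m where m: "interval3 G v x y = {m}" using med1[OF V] by blast
    have "m \<in> interval G v x" using m by (auto simp: interval3_def)
    then have "m \<in> verts H" using via[OF xy(1)] by blast
    \<comment> \<open>Equal distances turn the interval equations of \<open>H\<close> into those of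
      \<open>G\<close>; only membership in \<open>H\<close> remains as an extra condition.\<close>
    moreover have "z \<in> interval3 H v x y \<longleftrightarrow> z \<in> verts H \<and> z \<in> interval3 G v x y" for z
    proof (cases "z \<in> verts H")
      case True
      then have "z \<in> V" using sub(2) by blast
      then show ?thesis
        unfolding in_interval3_iff[OF v V] H.in_interval3_iff[OF vH xy]
        using True by (simp add: iso vH xy)
    qed (simp add: H.in_interval3_iff[OF vH xy])
    ultimately have "interval3 H v x y = {m}" using m by auto
    then show ?thesis by simp
  qed
  then show ?thesis using vH by (simp add: median_consistent_def)
qed

end

section \<open>Connectedness and edges of the graphs on I(u, v, w)\<close>

lemma ex_edge_if_connected:
  assumes "connected_graph K" "card (verts K) > 1"
  shows "edges K \<noteq> {}"
proof -
  obtain x y where xy: "x \<in> verts K" "y \<in> verts K" "x \<noteq> y"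
    using assms(2) by (metis card_le_Suc0_iff_eq card.infinite not_less One_nat_def not_one_less_zero)
  then obtain p where p: "path_between K x y p"
    using assms(1) by (auto simp: connected_graph_def)
  then obtain a b ps where "p = a # b # ps"
    using xy(3) by (auto simp: path_between_def neq_Nil_conv split: if_splits)
  then show ?thesis using p by (auto simp: path_between_def)
qed

text \<open>Serves both the induced graph of (C1) and G(u, v, w), since each has vertex set I(u, v,
  w).\<close>

lemma connected_graph_card_1:
  assumes "card (verts K) = 1"
  shows "verts K \<noteq> {} \<and> connected_graph K"
proof -
  obtain x where x: "verts K = {x}" using assms by (auto simp: card_1_singleton_iff)
  then have "path_between K x x [x]" by (simp add: path_between_def)
  then show ?thesis using x by (auto simp: connected_graph_def)
qed

text \<open>Lets statement (2) be applied with \<open>H\<close> equal to \<open>G\<close>.\<close>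

lemma convex_subgraph_self:
  assumes "simple_graph G" "v \<in> verts G"
  shows "convex_subgraph G v G"
  using assms
  by (auto simp: convex_subgraph_def subgraph_def shortest_path_def path_between_def)

lemma verts_induced_interval3:
  "verts (induced_subgraph G (interval3 G x y z)) = interval3 G x y z"
  using interval_subset_verts[of G x y] by (auto simp: induced_subgraph_def interval3_def)

lemma verts_interval_graph3: "verts (interval_graph3 G x y z) = interval3 G x y z"
  by (auto simp: interval_graph3_def graph_inter_def interval_graph_def interval3_def)

lemma edges_interval_graph:
  assumes "e \<in> edges (interval_graph G x y)"
  shows "e \<in> edges G \<and> e \<subseteq> interval G x y"
proof -
  obtain p where p: "shortest_path G x y p" "e \<in> path_edges p"
    using assms by (auto simp: interval_graph_def)
  then have "set p \<subseteq> interval G x y" by (auto simp: interval_def)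
  then show ?thesis
    using p path_edges_subset[OF p(2)] by (auto simp: shortest_path_def path_between_def)
qed

text \<open>G(u, v, w) may have fewer edges than the induced graph on I(u, v, w), but any edge it
  has is one between two medians.\<close>

lemma edges_interval_graph3:
  assumes "e \<in> edges (interval_graph3 G x y z)"
  shows "e \<in> edges G \<and> e \<subseteq> interval3 G x y z"
proof -
  have "e \<in> edges (interval_graph G x y)" "e \<in> edges (interval_graph G x z)"
    "e \<in> edges (interval_graph G y z)"
    using assms by (auto simp: interval_graph3_def graph_inter_def)
  then show ?thesis using edges_interval_graph by (metis Int_greatest interval3_def)
qed

theorem mainTheorem4:
  fixes G :: "'a graph"
  assumes "simple_graph G"
  shows
    "(median_graph G \<longleftrightarrow>
        (\<forall>v\<in>verts G. \<forall>H. convex_subgraph G v H \<longrightarrow> median_consistent H v)) \<and>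
     (median_graph G \<longleftrightarrow>
        (\<forall>u\<in>verts G. C1 G u)) \<and>
     (median_graph G \<longleftrightarrow>
        connected_graph G \<and> bipartite G \<and> (\<forall>u\<in>verts G. C0 G u \<and> C2 G u)) \<and>
     (median_graph G \<longleftrightarrow>
        (\<forall>u\<in>verts G. \<forall>v\<in>verts G. \<forall>w\<in>verts G.
           verts (interval_graph3 G u v w) \<noteq> {} \<and> connected_graph (interval_graph3 G u v w)))"
    (is "(?M \<longleftrightarrow> ?S2) \<and> (?M \<longleftrightarrow> ?S3) \<and> (?M \<longleftrightarrow> ?S4) \<and> (?M \<longleftrightarrow> ?S5)")
proof -
  have locI: "connected_simple_graph G" if "connected_graph G"
    using assms that by unfold_locales
  \<comment> \<open>Connectedness, required by the locale, is itself drawn from the first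
    premise.\<close>
  have median: ?M
    if "\<And>x y z. x \<in> verts G \<Longrightarrow> y \<in> verts G \<Longrightarrow> z \<in> verts G \<Longrightarrow> interval3 G x y z \<noteq> {}"
      "\<And>x y z. x \<in> verts G \<Longrightarrow> y \<in> verts G \<Longrightarrow> z \<in> verts G \<Longrightarrow> card (interval3 G x y z) > 1 \<Longrightarrow>
         \<exists>e\<in>edges G. e \<subseteq> interval3 G x y z"
    using connected_simple_graph.median_graphI[OF locI[OF connected_graph_if_interval3]] that
    by blast
  have card: "card (interval3 G x y z) = 1"
    if ?M "x \<in> verts G" "y \<in> verts G" "z \<in> verts G" for x y z
    using that by (auto simp: median_graph_def)
  then have ne: "interval3 G x y z \<noteq> {}"
    if ?M "x \<in> verts G" "y \<in> verts G" "z \<in> verts G" for x y z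
    using that by fastforce
  have loc: "connected_simple_graph G" if ?M
    using locI that by (simp add: median_graph_def)
  \<comment> \<open>From here on, the labels \<open>12\<close> to \<open>51\<close> name
    implications between the numbered statements, each with (1) at one end.\<close>
  have 12: ?S2 if ?M
    using connected_simple_graph.median_consistent_convex_subgraph[OF loc[OF that] that] by blast
  have 21: ?M if S2: ?S2
  proof -
    have one: "card (interval3 G x y z) = 1"
      if "x \<in> verts G" "y \<in> verts G" "z \<in> verts G" for x y z
      using S2 that convex_subgraph_self[OF assms] unfolding median_consistent_def by blast
    show ?M
    proof (rule median)
      fix x y z assume "x \<in> verts G" "y \<in> verts G" "z \<in> verts G"
      then show "interval3 G x y z \<noteq> {}" using one by fastforce
    \<comment> \<open>With exactly one median, the premise \<open>card > 1\<close> of the edge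
      condition is false.\<close>
    qed (simp add: one)
  qed
  have 13: ?S3 if ?M
    unfolding C1_def Let_def
    using connected_graph_card_1 card[OF that] by (metis verts_induced_interval3)
  have 31: ?M if S3: ?S3
  proof (rule median)
    fix x y z assume V: "x \<in> verts G" "y \<in> verts G" "z \<in> verts G"
    let ?K = "induced_subgraph G (interval3 G x y z)"
    have K: "interval3 G x y z \<noteq> {}" "connected_graph ?K"
      using S3 V by (auto simp: C1_def Let_def verts_induced_interval3)
    show "interval3 G x y z \<noteq> {}" by (fact K(1))
    assume "card (interval3 G x y z) > 1"
    then have "edges ?K \<noteq> {}"
      using ex_edge_if_connected[OF K(2)] by (simp add: verts_induced_interval3)
    then show "\<exists>e\<in>edges G. e \<subseteq> interval3 G x y z" by (auto simp: induced_subgraph_def)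
  qed
  have 14: ?S4 if M: ?M
  proof -
    interpret connected_simple_graph G by (rule loc[OF M])
    show ?thesis
    proof (intro conjI ballI)
      show "connected_graph G" by (rule connected)
      show "bipartite G"
        using bipartite_if_dist_edge_neq dist_edge_neq_if_interval3 ne[OF M] by metis
      fix u assume u: "u \<in> verts G"
      show "C0 G u" using C0_if_interval3_nonempty ne[OF M] u by metis
      \<comment> \<open>(C2) holds vacuously, as every I(u, v, w) is a singleton.\<close>
      show "C2 G u"
        using card[OF M u] by (simp add: C2_def Let_def verts_induced_interval3)
    qed
  qed
  have 41: ?M if S4: ?S4
  proof -
    interpret connected_simple_graph G using locI S4 by blast
    show ?M
    proof (rule median)
      fix x y z assume V: "x \<in> verts G" "y \<in> verts G" "z \<in> verts G"
      show "interval3 G x y z \<noteq> {}" using interval3_nonempty_if_C0 S4 V by blast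
      assume "card (interval3 G x y z) > 1"
      then have "edges (induced_subgraph G (interval3 G x y z)) \<noteq> {}"
        using S4 V by (auto simp: C2_def Let_def verts_induced_interval3)
      then show "\<exists>e\<in>edges G. e \<subseteq> interval3 G x y z" by (auto simp: induced_subgraph_def)
    qed
  qed
  have 15: ?S5 if ?M
    using connected_graph_card_1 card[OF that] by (metis verts_interval_graph3)
  have 51: ?M if S5: ?S5
  proof (rule median)
    fix x y z assume V: "x \<in> verts G" "y \<in> verts G" "z \<in> verts G"
    show "interval3 G x y z \<noteq> {}" using S5 V by (auto simp: verts_interval_graph3)
    assume "card (interval3 G x y z) > 1"
    then have "edges (interval_graph3 G x y z) \<noteq> {}"
      using ex_edge_if_connected S5 V by (metis verts_interval_graph3)
    then obtain e where "e \<in> edges (interval_graph3 G x y z)" by fast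
    from edges_interval_graph3[OF this]
    show "\<exists>e\<in>edges G. e \<subseteq> interval3 G x y z" by (intro bexI[of _ e]) auto
  qed
  show ?thesis
  proof (intro conjI)
    show "?M \<longleftrightarrow> ?S2" by (rule iffI) (erule 12 21)+
    show "?M \<longleftrightarrow> ?S3" by (rule iffI) (erule 13 31)+
    show "?M \<longleftrightarrow> ?S4" by (rule iffI) (erule 14 41)+
    show "?M \<longleftrightarrow> ?S5" by (rule iffI) (erule 15 51)+
  qed
qed

end
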